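(* Let $\mathcal{R} = \{R_n\}_{n=0}^{\infty}$ and $\mathcal{H} = \{H_n\}_{n=0}^{\infty}$ be sequences of nonempty finite sets of positive integers such that \[ \lim_{n\rightarrow\infty} \frac{\max(H_n)}{n} = 0. \] Then there exists an $\mathcal{R}$-basis $A$ of order $\mathcal{H}$ if and only if for every $N$ there exists a finite $\mathcal{R}$-basis $A_N$ of order $\mathcal{H}$ with $\max(A_N) \geq N$.
   Context: For a set $A$ of nonnegative integers, a nonnegative integer $n$ and a positive integer $h$, $r_A(n,h)$ denotes the number of representations $n = a_1 + \cdots + a_h$ with $a_1,\ldots,a_h \in A$ and $a_1 \leq \cdots \leq a_h$; and $r_A(n,H_n) = \sum_{h_n \in H_n} r_A(n,h_n)$. A set $A$ of nonnegative integers is an $\mathcal{R}$-basis of order $\mathcal{H}$ if $r_A(n,H_n)\in R_n$ for all integers $n\ge 0$. A nonempty finite set $A$ of nonnegative integers is a finite $\mathcal{R}$-basis of order $\mathcal{H}$ if $r_A(n,H_n)\in R_n$ for all integers $n$ with $0\le n\le \max(A)$. *)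

theory Defs
  imports Complex_Main
begin

text \<open>A representation \<open>n = a\<^sub>1 + \<dots> + a\<^sub>h\<close> with \<open>a\<^sub>1 \<le> \<dots> \<le> a\<^sub>h\<close> is the sorted list of its summands.\<close>

definition representations :: "nat set \<Rightarrow> nat \<Rightarrow> nat \<Rightarrow> nat list set" where
  "representations A n h = {xs. length xs = h \<and> set xs \<subseteq> A \<and> sorted xs \<and> sum_list xs = n}"

lemma finite_representations: "finite (representations A n h)"
proof (rule finite_subset)
  show "representations A n h \<subseteq> {xs. set xs \<subseteq> {..n} \<and> length xs = h}"
    by (auto simp: representations_def intro: member_le_sum_list)
  show "finite {xs. set xs \<subseteq> {..n} \<and> length xs = h}"
    by (rule finite_lists_length_eq) simp
qed

definition rep_count :: "nat set \<Rightarrow> nat \<Rightarrow> nat \<Rightarrow> nat" where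
  "rep_count A n h = card (representations A n h)"

definition rep_count_set :: "nat set \<Rightarrow> nat \<Rightarrow> nat set \<Rightarrow> nat" where
  "rep_count_set A n K = (\<Sum>h\<in>K. rep_count A n h)"

definition is_basis :: "(nat \<Rightarrow> nat set) \<Rightarrow> (nat \<Rightarrow> nat set) \<Rightarrow> nat set \<Rightarrow> bool" where
  "is_basis R H A \<longleftrightarrow> (\<forall>n. rep_count_set A n (H n) \<in> R n)"

definition is_finite_basis :: "(nat \<Rightarrow> nat set) \<Rightarrow> (nat \<Rightarrow> nat set) \<Rightarrow> nat set \<Rightarrow> bool" where
  "is_finite_basis R H A \<longleftrightarrow>
     finite A \<and> A \<noteq> {} \<and> (\<forall>n\<le>Max A. rep_count_set A n (H n) \<in> R n)"

end

theory Submission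
  imports Defs
begin

text \<open>The count at \<open>n\<close> only depends on \<open>A \<inter> {..n}\<close>. Hence truncating a basis at one of its elements
  gives a finite basis; the growth condition on \<open>H\<close> makes every basis infinite, so these elements
  are arbitrarily large. Conversely, a set all of whose initial segments extend to arbitrarily
  long finite bases is obtained by Koenig's lemma.\<close>

text \<open>Summands are nonnegative, so none of them exceeds the sum \<open>n\<close>.\<close>

lemma rep_count_set_cong:
  assumes "A \<inter> {..n} = B \<inter> {..n}"
  shows "rep_count_set A n K = rep_count_set B n K"
proof -
  have "xs \<in> representations A n h \<longleftrightarrow> xs \<in> representations B n h" for xs h
  proof (cases "sum_list xs = n")
    case True
    then have "set xs \<subseteq> {..n}"
      by (auto intro: member_le_sum_list)
    with assms have "set xs \<subseteq> A \<longleftrightarrow> set xs \<subseteq> B" by blast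
    then show ?thesis by (simp add: representations_def)
  qed (simp add: representations_def)
  then have "representations A n h = representations B n h" for h by blast
  then show ?thesis by (simp add: rep_count_set_def rep_count_def)
qed

lemma sum_list_le_length_mult:
  fixes xs :: "nat list"
  assumes "set xs \<subseteq> {..M}"
  shows "sum_list xs \<le> length xs * M"
  using assms by (induction xs) auto

text \<open>If all elements were at most \<open>M\<close>, a sum of \<open>h\<close> of them would
  be at most \<open>h * M\<close>. Since every \<open>n\<close> is represented,
  \<open>Max (H n)\<close> would grow at least linearly in \<open>n\<close>, against
  \<open>lim\<close>.\<close>

lemma is_basis_infinite:
  fixes R H :: "nat \<Rightarrow> nat set"
  assumes pos: "\<And>n r. r \<in> R n \<Longrightarrow> 0 < r"
    and fin: "\<And>n. finite (H n)"
    and lim: "(\<lambda>n. real (Max (H n)) / real n) \<longlonglongrightarrow> 0"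
    and basis: "is_basis R H A"
  shows "infinite A"
proof
  assume "finite A"
  then obtain M where M: "A \<subseteq> {..M}"
    by (meson atMost_iff finite_nat_set_iff_bounded_le subsetI)
  have bound: "n \<le> Max (H n) * M" for n
  proof -
    have "rep_count_set A n (H n) > 0"
      using basis pos by (auto simp: is_basis_def)
    then obtain h where h: "h \<in> H n" "rep_count A n h > 0"
      unfolding rep_count_set_def by (metis gr0I sum.neutral less_irrefl)
    then obtain xs where "xs \<in> representations A n h"
      unfolding rep_count_def by fastforce
    then have "n \<le> h * M"
      using sum_list_le_length_mult[of xs M] M by (auto simp: representations_def)
    also have "\<dots> \<le> Max (H n) * M"
      using h fin by simp
    finally show ?thesis .
  qed
  \<comment> \<open>The bound gives a ratio of at least 1/M when M > 0; the threshold 1/(M+1) lies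
    below this and also makes sense for M = 0.\<close>
  have "eventually (\<lambda>n. real (Max (H n)) / real n < 1 / (real M + 1)) sequentially"
    by (rule order_tendstoD[OF lim]) simp
  with eventually_gt_at_top[of 0]
  have "eventually (\<lambda>n. n > 0 \<and> real (Max (H n)) / real n < 1 / (real M + 1)) sequentially"
    by eventually_elim simp
  then obtain n where n: "n > 0" "real (Max (H n)) / real n < 1 / (real M + 1)"
    by (metis (no_types, lifting) eventually_happens' sequentially_bot)
  then have "real (Max (H n)) * (real M + 1) < real n"
    by (simp add: field_simps)
  moreover have "real n \<le> real (Max (H n)) * real M"
    using bound[of n] by (metis of_nat_le_iff of_nat_mult)
  moreover have "real (Max (H n)) \<ge> 0" by simp
  ultimately show False by (simp add: distrib_left)
qed

text \<open>Cutting at an element \<open>a\<close> of \<open>A\<close> makes \<open>a\<close> the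
  maximum, so only the counts at n \<le> a matter, and the cut leaves these unchanged.\<close>

lemma is_finite_basis_truncate:
  assumes "is_basis R H A" "a \<in> A"
  shows "is_finite_basis R H (A \<inter> {..a})" and "Max (A \<inter> {..a}) = a"
proof -
  show Max: "Max (A \<inter> {..a}) = a"
    using assms(2) by (intro Max_eqI) auto
  have "rep_count_set (A \<inter> {..a}) n (H n) \<in> R n" if "n \<le> a" for n
  proof -
    have "rep_count_set (A \<inter> {..a}) n (H n) = rep_count_set A n (H n)"
      using that by (intro rep_count_set_cong) auto
    then show ?thesis using assms(1) by (simp add: is_basis_def)
  qed
  then show "is_finite_basis R H (A \<inter> {..a})"
    unfolding is_finite_basis_def Max using assms(2) by auto
qed

lemma konig_nat_sets:
  fixes P :: "nat \<Rightarrow> nat set \<Rightarrow> bool"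
  assumes ex: "\<And>N. \<exists>A. P N A"
    and mono: "\<And>M N A. M \<le> N \<Longrightarrow> P N A \<Longrightarrow> P M A"
  obtains A where "\<And>n N. \<exists>B. P N B \<and> B \<inter> {..<n} = A \<inter> {..<n}"
proof -
  \<comment> \<open>The subsets of \<open>{..<n}\<close> are the nodes at level \<open>n\<close> of
    a binary tree; \<open>Q\<close> marks those that extend to solutions of \<open>P N\<close> for
    every \<open>N\<close>.\<close>
  define Q where "Q n S \<longleftrightarrow> (\<forall>N. \<exists>B. P N B \<and> B \<inter> {..<n} = S)" for n S
  have "\<exists>S'. Q (Suc n) S' \<and> S' \<inter> {..<n} = S" if Q: "Q n S" for n S
  proof -
    have S: "S \<subseteq> {..<n}" using Q by (auto simp: Q_def)
    \<comment> \<open>The two children of \<open>S\<close> leave out or include \<open>n\<close>. If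
      they failed at \<open>N1\<close> and \<open>N2\<close>, an extension of \<open>S\<close> good
      for the larger bound would, by \<open>mono\<close>, contradict one of the failures.\<close>
    have "Q (Suc n) S \<or> Q (Suc n) (insert n S)"
    proof (rule ccontr)
      assume "\<not> ?thesis"
      then obtain N1 N2
        where N1: "\<And>B. P N1 B \<Longrightarrow> B \<inter> {..<Suc n} \<noteq> S"
          and N2: "\<And>B. P N2 B \<Longrightarrow> B \<inter> {..<Suc n} \<noteq> insert n S"
        unfolding Q_def by metis
      obtain B where B: "P (max N1 N2) B" "B \<inter> {..<n} = S"
        using Q unfolding Q_def by blast
      then have "P N1 B" "P N2 B"
        using mono by (meson max.cobounded1 max.cobounded2)+
      moreover have "B \<inter> {..<Suc n} = S \<or> B \<inter> {..<Suc n} = insert n S"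
        using B(2) by (auto simp: lessThan_Suc)
      ultimately show False using N1 N2 by blast
    qed
    then show ?thesis using S by fastforce
  qed
  moreover have "Q 0 {}" using ex by (simp add: Q_def)
  ultimately obtain S where S: "\<And>n. Q n (S n)" "\<And>n. S (Suc n) \<inter> {..<n} = S n"
    using dependent_nat_choice[of Q "\<lambda>n S S'. S' \<inter> {..<n} = S"] by metis
  have restrict: "S m \<inter> {..<n} = S n" if "n \<le> m" for n m
    using that
  proof (induction m rule: dec_induct)
    case base
    show ?case using S(1)[of n] by (auto simp: Q_def)
  next
    case (step m)
    have "S (Suc m) \<inter> {..<n} = S (Suc m) \<inter> {..<m} \<inter> {..<n}"
      using step.hyps by auto
    then show ?case using S(2) step.IH by simp
  qed
  \<comment> \<open>The nodes on the branch cohere, so their union has each of them as an initial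
    segment.\<close>
  have "(\<Union>m. S m) \<inter> {..<n} = S n" for n
  proof -
    have "S m \<inter> {..<n} \<subseteq> S n" for m
      using restrict[of m n] restrict[of n m] by (cases "m \<le> n") auto
    moreover have "S n \<subseteq> {..<n}" using restrict[of n n] by auto
    ultimately show ?thesis by blast
  qed
  then show ?thesis using S(1) that unfolding Q_def by metis
qed

theorem theorem4:
  fixes R H :: "nat \<Rightarrow> nat set"
  assumes "\<And>n. finite (R n) \<and> R n \<noteq> {} \<and> (\<forall>r\<in>R n. 0 < r)"
    and "\<And>n. finite (H n) \<and> H n \<noteq> {} \<and> (\<forall>h\<in>H n. 0 < h)"
    and "(\<lambda>n. real (Max (H n)) / real n) \<longlonglongrightarrow> 0"
  shows "(\<exists>A. is_basis R H A) \<longleftrightarrow> (\<forall>N. \<exists>A. is_finite_basis R H A \<and> Max A \<ge> N)"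
proof
  assume "\<exists>A. is_basis R H A"
  then obtain A where A: "is_basis R H A" ..
  then have "infinite A"
    using assms by (intro is_basis_infinite) auto
  then have "\<exists>a\<in>A. N \<le> a" for N
    by (meson finite_nat_set_iff_bounded_le nat_le_linear)
  then show "\<forall>N. \<exists>A. is_finite_basis R H A \<and> Max A \<ge> N"
    using is_finite_basis_truncate[OF A] by metis
next
  assume "\<forall>N. \<exists>A. is_finite_basis R H A \<and> Max A \<ge> N"
  then obtain A where A:
    "\<And>n N. \<exists>B. (is_finite_basis R H B \<and> Max B \<ge> N) \<and> B \<inter> {..<n} = A \<inter> {..<n}"
    using konig_nat_sets[of "\<lambda>N B. is_finite_basis R H B \<and> Max B \<ge> N"]
    by (metis le_trans)
  have "rep_count_set A n (H n) \<in> R n" for n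
  proof -
    \<comment> \<open>Agreement below \<open>Suc n\<close> includes \<open>n\<close> itself, and
      \<open>Max B \<ge> n\<close> puts \<open>n\<close> in the range where \<open>B\<close> is
      constrained.\<close>
    obtain B where B: "is_finite_basis R H B" "Max B \<ge> n" "B \<inter> {..n} = A \<inter> {..n}"
      using A[of n "Suc n"] by (auto simp: lessThan_Suc_atMost)
    then show ?thesis
      using rep_count_set_cong[OF B(3)] by (metis is_finite_basis_def)
  qed
  then show "\<exists>A. is_basis R H A" by (auto simp: is_basis_def)
qed

end
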